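(* There is an absolute constant $C>0$ such that for each integer $N\ge1$ and every real $\delta$ with $\frac{1}{2^N}\le\delta\le1$, $$\frac{C^{-1}}{\sqrt N\,\sqrt{\log(2/\delta)}}\ \le\ \rho(\mathcal{B}^N_\delta)\ \le\ \frac{C}{\sqrt N\,\sqrt{\log(2/\delta)}} .$$
   Context: Here $[N]=\{1,\dots,N\}$ and $\{\pm1\}^N$ carries the normalized counting measure, $\mathbb{E}[f]=2^{-N}\sum_{x\in\{\pm1\}^N}f(x)$. Every $f\colon\{\pm1\}^N\to\mathbb{R}$ has the Fourier-Walsh expansion $f(x)=\sum_{S\subset[N]}\widehat f(S)x^S$, where $x^S=\prod_{k\in S}x_k$ (with $x^\emptyset=1$) and $\widehat f(S)=\mathbb{E}[f(x)\,x^S]$. Put $\|f\|_\infty=\max_{x}|f(x)|$. For a class $\mathcal{F}$ of functions on $\{\pm1\}^N$, its Boolean radius is $$\rho(\mathcal{F})=\sup\Big\{\rho\ge 0:\ \sum_{S\subset[N]}|\widehat f(S)|\rho^{|S|}\le\|f\|_\infty\ \text{for every } f\in\mathcal{F}\Big\}.$$ $\mathcal{B}^N_\delta$ denotes the class of all $f\colon\{\pm1\}^N\to\mathbb{R}$ satisfying $|\mathbb{E}[f]|\le(1-\delta)\|f\|_\infty$. $\log$ is the natural logarithm. *)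

theory Defs
  imports Complex_Main "HOL-Library.FuncSet" "HOL-Library.Extended_Real"
begin

text \<open>Points of the cube are functions on \<open>{1..N}\<close>, set to \<open>undefined\<close> elsewhere, so the cube has
  exactly \<open>2 ^ N\<close> elements. A function on the cube is a HOL function of type
  \<open>(nat \<Rightarrow> real) \<Rightarrow> real\<close>; everything below depends only on its restriction to \<open>cube N\<close>.\<close>

definition cube :: "nat \<Rightarrow> (nat \<Rightarrow> real) set" where
  "cube N = {1..N} \<rightarrow>\<^sub>E {-1, 1}"

definition cube_expectation :: "nat \<Rightarrow> ((nat \<Rightarrow> real) \<Rightarrow> real) \<Rightarrow> real" where
  "cube_expectation N f = (1 / 2 ^ N) * (\<Sum>x\<in>cube N. f x)"

definition walsh :: "nat set \<Rightarrow> (nat \<Rightarrow> real) \<Rightarrow> real" where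
  "walsh S x = (\<Prod>k\<in>S. x k)"

definition fourier_coeff :: "nat \<Rightarrow> ((nat \<Rightarrow> real) \<Rightarrow> real) \<Rightarrow> nat set \<Rightarrow> real" where
  "fourier_coeff N f S = cube_expectation N (\<lambda>x. f x * walsh S x)"

definition cube_sup_norm :: "nat \<Rightarrow> ((nat \<Rightarrow> real) \<Rightarrow> real) \<Rightarrow> real" where
  "cube_sup_norm N f = Max ((\<lambda>x. \<bar>f x\<bar>) ` cube N)"

text \<open>The supremum is taken in \<open>ereal\<close>, since for some classes (for instance the constant
  functions) the set of admissible \<open>\<rho>\<close> is unbounded.\<close>

definition boolean_radius :: "nat \<Rightarrow> ((nat \<Rightarrow> real) \<Rightarrow> real) set \<Rightarrow> ereal" where
  "boolean_radius N F =
     Sup (ereal ` {\<rho>. \<rho> \<ge> 0 \<and>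
       (\<forall>f\<in>F. (\<Sum>S\<in>Pow {1..N}. \<bar>fourier_coeff N f S\<bar> * \<rho> ^ card S) \<le> cube_sup_norm N f)})"

definition B_class :: "nat \<Rightarrow> real \<Rightarrow> ((nat \<Rightarrow> real) \<Rightarrow> real) set" where
  "B_class N \<delta> = {f. \<bar>cube_expectation N f\<bar> \<le> (1 - \<delta>) * cube_sup_norm N f}"

end

theory Submission
  imports Defs "HOL-Analysis.Convex" "HOL-Library.Disjoint_Sets"
begin

text \<open>Write \<open>L = ln (2 / \<delta>)\<close>.

  Lower bound on the radius. Normalize \<open>f\<close> to sup norm \<open>1\<close> and, up to a sign, to nonnegative mean. Then
  \<open>g = (1 - f) / 2\<close> takes values in \<open>[0, 1]\<close> and has mean \<open>m \<ge> \<delta> / 2\<close>. In these terms the radius inequality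
  for \<open>f\<close> says exactly that the weighted sum of the nonconstant coefficients of \<open>g\<close> is at most \<open>m\<close>. A
  \<open>[0, 1]\<close>-valued function of small mean has small low-degree Fourier weight: by Bonami's
  hypercontractivity,
  \<open>\<Sum>S. \<eta> ^ |S| * g^(S)^2 \<le> m powr (2 / (1 + \<eta>))\<close> (\<open>noise_energy_le_mean_powr\<close>). For
  \<open>\<eta> = 1 / (2 ln (1 / m))\<close> the right-hand side is at most \<open>3 m^2\<close>, so hardly anything is lost against the
  trivial bound \<open>m^2\<close> from below. The Cauchy-Schwarz inequality with the weights \<open>\<eta> ^ |S|\<close> then leaves the
  factor \<open>(1 + \<rho>^2 / \<eta>) ^ N - 1\<close>, which is at most \<open>1 / 3\<close> as soon as \<open>8 N L \<rho>^2 \<le> 1\<close>.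

  Upper bound on the radius. Split \<open>k\<close> times \<open>n\<close> of the coordinates into \<open>k\<close> blocks of odd size \<open>n\<close>, where
  \<open>2 ^ k\<close> is about \<open>1 / \<delta>\<close> and \<open>n\<close> about \<open>N / k\<close>, and let \<open>A\<close> be the event that every block sum is
  positive. Its measure is exactly \<open>2 ^ -k\<close>, so \<open>f = 1 - 2 * 1_A\<close> belongs to the class. On \<open>A\<close> the sum of
  the coordinates in the blocks is the sum of the absolute block sums, each of which has mean at least
  \<open>sqrt n / 2\<close>; hence the absolute degree-one coefficients of \<open>f\<close> add up to at least
  \<open>2 ^ -k * k * sqrt n\<close> (\<open>block_test_function\<close>). The constant and linear terms alone then force
  \<open>\<rho> * k * sqrt n \<le> 2\<close>, and \<open>k * sqrt n\<close> is of the order of \<open>sqrt (N L)\<close>.\<close>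

section \<open>The two-point inequality\<close>

text \<open>The left-hand side is the second-order Taylor polynomial at \<open>0\<close>. It lies below because the second
  derivative of the right-hand side is smallest there: \<open>(1 + y) powr (\<eta> - 1) + (1 - y) powr (\<eta> - 1)\<close> is
  at least \<open>2\<close>, by the inequality of the arithmetic and geometric mean. Two integrations give the claim.\<close>

lemma powr_even_part_lower_bound:
  fixes \<eta> y :: real
  assumes \<eta>: "0 < \<eta>" "\<eta> \<le> 1" and y: "0 \<le> y" "y \<le> 1"
  shows "2 + (1 + \<eta>) * \<eta> * y\<^sup>2 \<le> (1 + y) powr (1 + \<eta>) + (1 - y) powr (1 + \<eta>)"
proof -
  have odd_part: "2 * \<eta> * z \<le> (1 + z) powr \<eta> - (1 - z) powr \<eta>" if z: "0 \<le> z" "z < 1" for z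
  proof -
    define h where "h = (\<lambda>t::real. (1 + t) powr \<eta> - (1 - t) powr \<eta> - 2 * \<eta> * t)"
    have "h 0 \<le> h z"
    proof (rule DERIV_nonneg_imp_nondecreasing[where f = h])
      fix t assume t: "0 \<le> t" "t \<le> z"
      have d: "DERIV h t :> \<eta> * ((1 + t) powr (\<eta> - 1) + (1 - t) powr (\<eta> - 1) - 2)"
        unfolding h_def using t z by (auto intro!: derivative_eq_intros simp: algebra_simps)
      define A where "A = (1 + t) powr ((\<eta> - 1) / 2)"
      define B where "B = (1 - t) powr ((\<eta> - 1) / 2)"
      have sq: "(1 + t) powr (\<eta> - 1) = A\<^sup>2" "(1 - t) powr (\<eta> - 1) = B\<^sup>2"
        unfolding A_def B_def power2_eq_square by (simp_all flip: powr_add)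
      have "A * B = ((1 + t) * (1 - t)) powr ((\<eta> - 1) / 2)"
        unfolding A_def B_def using t z by (subst powr_mult) auto
      also have "\<dots> \<ge> ((1 + t) * (1 - t)) powr 0"
      proof (rule powr_mono')
        show "(1 + t) * (1 - t) \<le> 1" by (simp add: algebra_simps)
      qed (use t z \<eta> in auto)
      finally have "1 \<le> A * B" using t z by simp
      moreover have "2 * (A * B) \<le> A\<^sup>2 + B\<^sup>2"
        using sum_squares_bound[of A B] by simp
      ultimately have "0 \<le> A\<^sup>2 + B\<^sup>2 - 2" by linarith
      then show "\<exists>d. DERIV h t :> d \<and> 0 \<le> d"
        using d \<eta> unfolding sq by (intro exI conjI) auto
    qed (use z in auto)
    then show ?thesis by (simp add: h_def)
  qed
  define \<phi> where "\<phi> = (\<lambda>t::real. (1 + t) powr (1 + \<eta>) + (1 - t) powr (1 + \<eta>) - (1 + \<eta>) * \<eta> * t\<^sup>2)"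
  have "\<phi> 0 \<le> \<phi> y"
  proof (rule DERIV_nonneg_imp_increasing_open[where f = \<phi>])
    fix t assume t: "0 < t" "t < y"
    have "DERIV \<phi> t :> (1 + \<eta>) * ((1 + t) powr \<eta> - (1 - t) powr \<eta> - 2 * \<eta> * t)"
      unfolding \<phi>_def using t y by (auto intro!: derivative_eq_intros simp: algebra_simps)
    moreover have "0 \<le> (1 + \<eta>) * ((1 + t) powr \<eta> - (1 - t) powr \<eta> - 2 * \<eta> * t)"
      using odd_part[of t] t y \<eta> by (intro mult_nonneg_nonneg) auto
    ultimately show "\<exists>d. DERIV \<phi> t :> d \<and> 0 \<le> d" by blast
  next
    show "continuous_on {0..y} \<phi>"
      unfolding \<phi>_def using y \<eta> by (intro continuous_intros continuous_on_powr') auto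
  qed (use y in auto)
  then show ?thesis by (simp add: \<phi>_def)
qed

lemma powr_le_tangent:
  fixes s x :: real
  assumes "0 \<le> s" "s \<le> 1" "0 \<le> x"
  shows "(1 + x) powr s \<le> 1 + s * x"
  using Youngs_inequality_0[of s "1 - s" "1 + x" 1] assms by (simp add: algebra_simps)

text \<open>Bonami's two-point inequality between the norms with exponents \<open>2\<close> and \<open>p = 1 + \<eta>\<close>. After scaling to
  mean \<open>1\<close>, both \<open>(1 + \<eta> y^2) powr (p / 2)\<close> (by concavity) and the mean of the two \<open>p\<close>-th powers (by the
  Taylor bound) are compared with the common value \<open>1 + p \<eta> y^2 / 2\<close>.\<close>

lemma two_point_inequality:
  fixes u v \<eta> :: real
  assumes \<eta>: "0 < \<eta>" "\<eta> \<le> 1" and uv: "0 \<le> u" "0 \<le> v"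
  shows "((u + v) / 2)\<^sup>2 + \<eta> * ((u - v) / 2)\<^sup>2
    \<le> ((u powr (1 + \<eta>) + v powr (1 + \<eta>)) / 2) powr (2 / (1 + \<eta>))"
proof (cases "u + v = 0")
  case True
  then have "u = 0" "v = 0" using uv by linarith+
  then show ?thesis by simp
next
  case False
  define p where "p = 1 + \<eta>"
  have p: "1 < p" "p \<le> 2" "p - 1 = \<eta>" "p > 0" using \<eta> by (auto simp: p_def)
  define a where "a = (u + v) / 2"
  define y where "y = \<bar>u - v\<bar> / (u + v)"
  have a: "a > 0" using False uv by (auto simp: a_def)
  have y: "0 \<le> y" "y \<le> 1" using False uv by (auto simp: y_def divide_simps)
  have uv_eq: "u powr p + v powr p = (a * (1 + y)) powr p + (a * (1 - y)) powr p"
  proof (cases "u \<ge> v")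
    case True
    then have "a * (1 + y) = u" "a * (1 - y) = v" using False by (auto simp: a_def y_def field_simps)
    then show ?thesis by simp
  next
    case F: False
    then have "a * (1 + y) = v" "a * (1 - y) = u" using False by (auto simp: a_def y_def field_simps)
    then show ?thesis by simp
  qed
  have "(1 + \<eta> * y\<^sup>2) powr (p / 2) \<le> 1 + (p / 2) * (\<eta> * y\<^sup>2)"
    using p \<eta> by (intro powr_le_tangent) auto
  also have "\<dots> \<le> ((1 + y) powr p + (1 - y) powr p) / 2"
    using powr_even_part_lower_bound[OF \<eta> y] by (simp add: p_def)
  finally have "((1 + \<eta> * y\<^sup>2) powr (p / 2)) powr (2 / p) \<le> (((1 + y) powr p + (1 - y) powr p) / 2) powr (2 / p)"
    using p by (intro powr_mono2) auto
  moreover have "((1 + \<eta> * y\<^sup>2) powr (p / 2)) powr (2 / p) = 1 + \<eta> * y\<^sup>2"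
    using p \<eta> by (simp add: powr_powr add_pos_nonneg)
  ultimately have *: "1 + \<eta> * y\<^sup>2 \<le> (((1 + y) powr p + (1 - y) powr p) / 2) powr (2 / p)" by simp
  have "((u + v) / 2)\<^sup>2 + \<eta> * ((u - v) / 2)\<^sup>2 = a\<^sup>2 * (1 + \<eta> * y\<^sup>2)"
    using False by (simp add: a_def y_def power_divide field_simps power_mult_distrib)
  also have "\<dots> \<le> a\<^sup>2 * (((1 + y) powr p + (1 - y) powr p) / 2) powr (2 / p)"
    by (intro mult_left_mono *) auto
  also have "a\<^sup>2 = (a powr p) powr (2 / p)"
    using p a by (simp add: powr_powr)
  also have "(a powr p) powr (2 / p) * (((1 + y) powr p + (1 - y) powr p) / 2) powr (2 / p)
     = (a powr p * (((1 + y) powr p + (1 - y) powr p) / 2)) powr (2 / p)"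
    by (rule powr_mult[symmetric])
  also have "a powr p * (((1 + y) powr p + (1 - y) powr p) / 2) = (u powr p + v powr p) / 2"
    unfolding uv_eq powr_mult by (simp add: distrib_left)
  finally show ?thesis by (simp add: p_def)
qed

section \<open>Expectations and coefficients on the cube\<close>

lemma finite_cube [simp]: "finite (cube N)"
  unfolding cube_def by (auto intro!: finite_PiE)

lemma cube_nonempty [simp]: "cube N \<noteq> {}"
  unfolding cube_def by (auto simp: PiE_eq_empty_iff)

lemma card_cube: "card (cube N) = 2 ^ N"
proof -
  have "card {- 1, 1 :: real} = 2" by simp
  then show ?thesis unfolding cube_def by (subst card_PiE) (simp_all del: card_insert_disjoint)
qed

lemma cube_coordinate: "x \<in> cube N \<Longrightarrow> i \<in> {1..N} \<Longrightarrow> x i = 1 \<or> x i = - 1"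
  using PiE_mem[of x "{1..N}" "\<lambda>_. {- 1, 1}" i] by (auto simp: cube_def)

lemma cube_expectation_mono:
  "(\<And>x. x \<in> cube N \<Longrightarrow> f x \<le> g x) \<Longrightarrow> cube_expectation N f \<le> cube_expectation N g"
  unfolding cube_expectation_def by (intro mult_left_mono sum_mono) auto

lemma cube_expectation_cong:
  "(\<And>x. x \<in> cube N \<Longrightarrow> f x = g x) \<Longrightarrow> cube_expectation N f = cube_expectation N g"
  unfolding cube_expectation_def by (simp cong: sum.cong)

lemma cube_expectation_add:
  "cube_expectation N (\<lambda>x. f x + g x) = cube_expectation N f + cube_expectation N g"
  by (simp add: cube_expectation_def sum.distrib algebra_simps)

lemma cube_expectation_diff:
  "cube_expectation N (\<lambda>x. f x - g x) = cube_expectation N f - cube_expectation N g"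
  by (simp add: cube_expectation_def sum_subtractf algebra_simps)

lemma cube_expectation_cmult:
  "cube_expectation N (\<lambda>x. c * f x) = c * cube_expectation N f"
  by (simp add: cube_expectation_def flip: sum_distrib_left)

lemma cube_expectation_const: "cube_expectation N (\<lambda>x. c) = c"
  by (simp add: cube_expectation_def card_cube)

lemma cube_expectation_sum:
  "cube_expectation N (\<lambda>x. \<Sum>i\<in>I. f i x) = (\<Sum>i\<in>I. cube_expectation N (f i))"
  unfolding cube_expectation_def by (subst sum.swap) (simp add: sum_distrib_left)

lemma sum_cube_Suc:
  fixes f :: "(nat \<Rightarrow> real) \<Rightarrow> real"
  shows "(\<Sum>x\<in>cube (Suc N). f x) = (\<Sum>x\<in>cube N. f (x(Suc N := 1)) + f (x(Suc N := - 1)))"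
proof -
  have I: "{1..Suc N} = insert (Suc N) {1..N}" by auto
  have inj: "inj_on (\<lambda>(y, g). g(Suc N := y)) ({-1, 1::real} \<times> cube N)"
    unfolding cube_def by (rule inj_combinator) auto
  have "cube (Suc N) = (\<lambda>(y, g). g(Suc N := y)) ` ({-1, 1} \<times> cube N)"
    unfolding cube_def I by (rule PiE_insert_eq)
  then have "(\<Sum>x\<in>cube (Suc N). f x) = (\<Sum>(y, g)\<in>{-1, 1} \<times> cube N. f (g(Suc N := y)))"
    by (simp only: sum.reindex[OF inj]) (simp add: case_prod_unfold)
  also have "\<dots> = (\<Sum>y\<in>{-1, 1}. \<Sum>g\<in>cube N. f (g(Suc N := y)))"
    by (simp only: sum.cartesian_product)
  finally show ?thesis by (simp add: sum.distrib add.commute)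
qed

lemma cube_expectation_Suc:
  "cube_expectation (Suc N) f =
    (cube_expectation N (\<lambda>x. f (x(Suc N := 1))) + cube_expectation N (\<lambda>x. f (x(Suc N := - 1)))) / 2"
  by (simp add: cube_expectation_def sum_cube_Suc sum.distrib field_simps)

lemma walsh_fresh: "i \<notin> S \<Longrightarrow> walsh S (x(i := c)) = walsh S x"
  unfolding walsh_def by (intro prod.cong) auto

lemma fourier_coeff_Suc:
  assumes "S \<subseteq> {1..N}"
  shows "fourier_coeff (Suc N) f S =
      (fourier_coeff N (\<lambda>x. f (x(Suc N := 1))) S + fourier_coeff N (\<lambda>x. f (x(Suc N := - 1))) S) / 2"
    and "fourier_coeff (Suc N) f (insert (Suc N) S) =
      (fourier_coeff N (\<lambda>x. f (x(Suc N := 1))) S - fourier_coeff N (\<lambda>x. f (x(Suc N := - 1))) S) / 2"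
proof -
  have S: "Suc N \<notin> S" "finite S" using assms by (auto intro: finite_subset)
  have ins: "walsh (insert (Suc N) S) (x(Suc N := c)) = c * walsh S x" for x and c :: real
    using walsh_fresh[OF S(1), of x c] S by (simp add: walsh_def)
  show "fourier_coeff (Suc N) f S =
      (fourier_coeff N (\<lambda>x. f (x(Suc N := 1))) S + fourier_coeff N (\<lambda>x. f (x(Suc N := - 1))) S) / 2"
    by (simp add: fourier_coeff_def cube_expectation_Suc walsh_fresh[OF S(1)])
  have "cube_expectation N (\<lambda>x. f (x(Suc N := - 1)) * (- walsh S x))
      = - cube_expectation N (\<lambda>x. f (x(Suc N := - 1)) * walsh S x)"
    by (simp add: cube_expectation_def sum_negf)
  then show "fourier_coeff (Suc N) f (insert (Suc N) S) =
      (fourier_coeff N (\<lambda>x. f (x(Suc N := 1))) S - fourier_coeff N (\<lambda>x. f (x(Suc N := - 1))) S) / 2"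
    by (simp add: fourier_coeff_def cube_expectation_Suc ins)
qed

section \<open>Hypercontractivity\<close>

text \<open>The squared norm of \<open>T g\<close>, where the noise operator \<open>T\<close> multiplies the coefficient of \<open>S\<close> by
  \<open>sqrt \<eta> ^ |S|\<close>.\<close>

definition noise_energy :: "nat \<Rightarrow> real \<Rightarrow> ((nat \<Rightarrow> real) \<Rightarrow> real) \<Rightarrow> real" where
  "noise_energy N \<eta> g = (\<Sum>S\<in>Pow {1..N}. \<eta> ^ card S * (fourier_coeff N g S)\<^sup>2)"

lemma sum_Pow_Suc:
  fixes F :: "nat set \<Rightarrow> real"
  shows "(\<Sum>S\<in>Pow {1..Suc N}. F S) = (\<Sum>S\<in>Pow {1..N}. F S + F (insert (Suc N) S))"
proof -
  have I: "{1..Suc N} = insert (Suc N) {1..N}" by auto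
  have inj: "inj_on (insert (Suc N)) (Pow {1..N})"
  proof (rule inj_onI)
    fix S T assume "S \<in> Pow {1..N}" "T \<in> Pow {1..N}" and eq: "insert (Suc N) S = insert (Suc N) T"
    then have "Suc N \<notin> S" "Suc N \<notin> T" by auto
    with eq show "S = T" by (simp add: insert_ident)
  qed
  have "(\<Sum>S\<in>Pow {1..Suc N}. F S) = (\<Sum>S\<in>Pow {1..N}. F S) + (\<Sum>S\<in>insert (Suc N) ` Pow {1..N}. F S)"
    unfolding I Pow_insert by (intro sum.union_disjoint) auto
  then show ?thesis unfolding sum.reindex[OF inj] o_def sum.distrib .
qed

lemma weighted_Cauchy_Schwarz:
  fixes \<alpha> \<beta> w :: "'a \<Rightarrow> real"
  assumes "\<And>i. i \<in> I \<Longrightarrow> 0 \<le> w i"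
  shows "(\<Sum>i\<in>I. w i * (\<alpha> i * \<beta> i))
     \<le> sqrt (\<Sum>i\<in>I. w i * (\<alpha> i)\<^sup>2) * sqrt (\<Sum>i\<in>I. w i * (\<beta> i)\<^sup>2)"
proof -
  have "(\<Sum>i\<in>I. w i * (\<alpha> i * \<beta> i))\<^sup>2 = (\<Sum>i\<in>I. (sqrt (w i) * \<alpha> i) * (sqrt (w i) * \<beta> i))\<^sup>2"
    using assms by (intro arg_cong[of _ _ "\<lambda>z. z\<^sup>2"] sum.cong) (auto simp: algebra_simps)
  also have "\<dots> \<le> (\<Sum>i\<in>I. (sqrt (w i) * \<alpha> i)\<^sup>2) * (\<Sum>i\<in>I. (sqrt (w i) * \<beta> i)\<^sup>2)"
    by (rule Cauchy_Schwarz_ineq_sum)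
  also have "\<dots> = (\<Sum>i\<in>I. w i * (\<alpha> i)\<^sup>2) * (\<Sum>i\<in>I. w i * (\<beta> i)\<^sup>2)"
    using assms by (simp add: power_mult_distrib)
  finally show ?thesis unfolding real_sqrt_mult[symmetric] by (rule real_le_rsqrt)
qed

text \<open>Splitting off the last coordinate, the coefficients of \<open>g\<close> are the half sums and half differences of
  those of its two restrictions. Expanding the squares leaves one mixed term; its factor \<open>1 - \<eta>\<close> is
  nonnegative, so the Cauchy-Schwarz inequality bounds it. The resulting right-hand side equals
  \<open>((A + B) / 2)^2 + \<eta> * ((A - B) / 2)^2\<close>, written so that it is visibly increasing in \<open>A\<close> and \<open>B\<close>.\<close>

lemma noise_energy_Suc_le:
  fixes g :: "(nat \<Rightarrow> real) \<Rightarrow> real" and \<eta> :: real and N :: nat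
  assumes \<eta>: "0 \<le> \<eta>" "\<eta> \<le> 1"
  defines "A \<equiv> sqrt (noise_energy N \<eta> (\<lambda>x. g (x(Suc N := 1))))"
    and "B \<equiv> sqrt (noise_energy N \<eta> (\<lambda>x. g (x(Suc N := - 1))))"
  shows "noise_energy (Suc N) \<eta> g \<le> (1 + \<eta>) / 4 * (A\<^sup>2 + B\<^sup>2) + (1 - \<eta>) / 2 * (A * B)"
proof -
  let ?\<alpha> = "fourier_coeff N (\<lambda>x. g (x(Suc N := 1)))"
  let ?\<beta> = "fourier_coeff N (\<lambda>x. g (x(Suc N := - 1)))"
  have A2: "A\<^sup>2 = (\<Sum>S\<in>Pow {1..N}. \<eta> ^ card S * (?\<alpha> S)\<^sup>2)"
    unfolding A_def noise_energy_def using \<eta> by (intro real_sqrt_pow2 sum_nonneg) auto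
  have B2: "B\<^sup>2 = (\<Sum>S\<in>Pow {1..N}. \<eta> ^ card S * (?\<beta> S)\<^sup>2)"
    unfolding B_def noise_energy_def using \<eta> by (intro real_sqrt_pow2 sum_nonneg) auto
  have AB: "(\<Sum>S\<in>Pow {1..N}. \<eta> ^ card S * (?\<alpha> S * ?\<beta> S)) \<le> A * B"
    unfolding A_def B_def noise_energy_def using \<eta> by (intro weighted_Cauchy_Schwarz) auto
  have "noise_energy (Suc N) \<eta> g = (\<Sum>S\<in>Pow {1..N}. \<eta> ^ card S * ((?\<alpha> S + ?\<beta> S) / 2)\<^sup>2
      + \<eta> ^ Suc (card S) * ((?\<alpha> S - ?\<beta> S) / 2)\<^sup>2)"
    unfolding noise_energy_def sum_Pow_Suc
  proof (intro sum.cong refl)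
    fix S assume "S \<in> Pow {1..N}"
    then have S: "S \<subseteq> {1..N}" by simp
    then have "card (insert (Suc N) S) = Suc (card S)"
      by (subst card_insert_disjoint) (auto intro: finite_subset)
    then show "\<eta> ^ card S * (fourier_coeff (Suc N) g S)\<^sup>2 +
        \<eta> ^ card (insert (Suc N) S) * (fourier_coeff (Suc N) g (insert (Suc N) S))\<^sup>2 =
       \<eta> ^ card S * ((?\<alpha> S + ?\<beta> S) / 2)\<^sup>2 + \<eta> ^ Suc (card S) * ((?\<alpha> S - ?\<beta> S) / 2)\<^sup>2"
      by (simp only: fourier_coeff_Suc[OF S])
  qed
  also have "\<dots> = (\<Sum>S\<in>Pow {1..N}. (1 + \<eta>) / 4 * (\<eta> ^ card S * (?\<alpha> S)\<^sup>2)
      + (1 + \<eta>) / 4 * (\<eta> ^ card S * (?\<beta> S)\<^sup>2) + (1 - \<eta>) / 2 * (\<eta> ^ card S * (?\<alpha> S * ?\<beta> S)))"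
    by (intro sum.cong refl) (simp add: field_simps power2_eq_square)
  also have "\<dots> = (1 + \<eta>) / 4 * (A\<^sup>2 + B\<^sup>2)
      + (1 - \<eta>) / 2 * (\<Sum>S\<in>Pow {1..N}. \<eta> ^ card S * (?\<alpha> S * ?\<beta> S))"
    unfolding A2 B2 by (simp only: sum.distrib sum_distrib_left[symmetric] distrib_left)
  also have "\<dots> \<le> (1 + \<eta>) / 4 * (A\<^sup>2 + B\<^sup>2) + (1 - \<eta>) / 2 * (A * B)"
    using AB \<eta> by (intro add_left_mono mult_left_mono) auto
  finally show ?thesis .
qed

lemma noise_energy_nonneg: "0 \<le> \<eta> \<Longrightarrow> 0 \<le> noise_energy N \<eta> g"
  unfolding noise_energy_def by (intro sum_nonneg) auto

lemma cube_Suc_upd: "x \<in> cube N \<Longrightarrow> c = 1 \<or> c = -1 \<Longrightarrow> x(Suc N := c) \<in> cube (Suc N)"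
  unfolding cube_def by (auto simp: PiE_def extensional_def Pi_def)

text \<open>Hypercontractivity for \<open>[0, 1]\<close>-valued functions, stated with the mean itself in place of the mean of
  \<open>g powr (1 + \<eta>)\<close>, which it bounds from above. In this form the induction on the dimension needs only
  the two-point inequality for the roots \<open>u\<close> and \<open>v\<close>, of order \<open>p = 1 + \<eta>\<close>, of the means of the two
  restrictions, because \<open>u powr p\<close> and \<open>v powr p\<close> average to the mean of \<open>g\<close>.\<close>

lemma noise_energy_le_mean_powr:
  fixes g :: "(nat \<Rightarrow> real) \<Rightarrow> real" and \<eta> :: real
  assumes \<eta>: "0 < \<eta>" "\<eta> \<le> 1" and "\<And>x. x \<in> cube N \<Longrightarrow> 0 \<le> g x \<and> g x \<le> 1"
  shows "noise_energy N \<eta> g \<le> cube_expectation N g powr (2 / (1 + \<eta>))"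
  using assms(3)
proof (induction N arbitrary: g)
  case 0
  have c: "cube 0 = {\<lambda>_. undefined}" by (simp add: cube_def)
  let ?a = "g (\<lambda>_. undefined)"
  have a: "0 \<le> ?a" "?a \<le> 1" using 0[of "\<lambda>_. undefined"] c by auto
  have "?a\<^sup>2 \<le> ?a powr (2 / (1 + \<eta>))"
  proof (cases "?a = 0")
    case False
    then have "?a\<^sup>2 = ?a powr 2" using a by simp
    also have "\<dots> \<le> ?a powr (2 / (1 + \<eta>))"
      using a \<eta> by (intro powr_mono') (auto simp: divide_simps)
    finally show ?thesis .
  qed auto
  then show ?case
    by (simp add: noise_energy_def fourier_coeff_def cube_expectation_def c walsh_def)
next
  case (Suc N)
  define p where "p = 1 + \<eta>"
  have p: "p > 0" using \<eta> by (simp add: p_def)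
  let ?g = "\<lambda>c x. g (x(Suc N := c))"
  define A where "A = sqrt (noise_energy N \<eta> (?g 1))"
  define B where "B = sqrt (noise_energy N \<eta> (?g (- 1)))"
  define u where "u = cube_expectation N (?g 1) powr (1 / p)"
  define v where "v = cube_expectation N (?g (- 1)) powr (1 / p)"
  have bd: "0 \<le> ?g c x \<and> ?g c x \<le> 1" if "x \<in> cube N" "c = 1 \<or> c = -1" for x c
    using Suc.prems[OF cube_Suc_upd[OF that]] .
  have mean_nonneg: "0 \<le> cube_expectation N (?g c)" if "c = 1 \<or> c = -1" for c
    using cube_expectation_mono[of N "\<lambda>_. 0" "?g c"] bd that by (simp add: cube_expectation_const)
  have root: "sqrt (noise_energy N \<eta> (?g c)) \<le> cube_expectation N (?g c) powr (1 / p)"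
    if "c = 1 \<or> c = -1" for c
  proof (rule real_le_lsqrt)
    have "noise_energy N \<eta> (?g c) \<le> cube_expectation N (?g c) powr (2 / p)"
      unfolding p_def using bd[OF _ that] by (rule Suc.IH)
    also have "\<dots> = (cube_expectation N (?g c) powr (1 / p))\<^sup>2"
      unfolding power2_eq_square by (simp flip: powr_add)
    finally show "noise_energy N \<eta> (?g c) \<le> (cube_expectation N (?g c) powr (1 / p))\<^sup>2" .
  qed (use \<eta> in \<open>auto simp: noise_energy_nonneg\<close>)
  have AB: "0 \<le> A" "A \<le> u" "0 \<le> B" "B \<le> v"
    unfolding A_def B_def u_def v_def using root \<eta> by (auto simp: noise_energy_nonneg)
  have uv: "0 \<le> u" "0 \<le> v" by (auto simp: u_def v_def)
  have "noise_energy (Suc N) \<eta> g \<le> (1 + \<eta>) / 4 * (A\<^sup>2 + B\<^sup>2) + (1 - \<eta>) / 2 * (A * B)"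
    unfolding A_def B_def using \<eta> by (intro noise_energy_Suc_le) auto
  also have "\<dots> \<le> (1 + \<eta>) / 4 * (u\<^sup>2 + v\<^sup>2) + (1 - \<eta>) / 2 * (u * v)"
    using AB uv \<eta> by (intro add_mono mult_left_mono mult_mono power_mono) auto
  also have "\<dots> = ((u + v) / 2)\<^sup>2 + \<eta> * ((u - v) / 2)\<^sup>2"
    by (simp add: field_simps power2_eq_square)
  also have "\<dots> \<le> ((u powr p + v powr p) / 2) powr (2 / p)"
    unfolding p_def using \<eta> uv by (intro two_point_inequality) auto
  also have "(u powr p + v powr p) / 2 = cube_expectation (Suc N) g"
    using p mean_nonneg by (simp add: u_def v_def powr_powr cube_expectation_Suc)
  finally show ?case by (simp add: p_def)
qed


section \<open>Sign flips\<close>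

definition flip :: "nat set \<Rightarrow> (nat \<Rightarrow> real) \<Rightarrow> nat \<Rightarrow> real" where
  "flip D x = (\<lambda>i. if i \<in> D then - x i else x i)"

lemma flip_in_cube: "D \<subseteq> {1..N} \<Longrightarrow> x \<in> cube N \<Longrightarrow> flip D x \<in> cube N"
  unfolding cube_def flip_def PiE_iff extensional_def by auto

lemma flip_flip: "flip D (flip D x) = x"
  by (auto simp: flip_def)

lemma cube_expectation_flip:
  assumes "D \<subseteq> {1..N}"
  shows "cube_expectation N (\<lambda>x. f (flip D x)) = cube_expectation N f"
proof -
  have "(\<Sum>x\<in>cube N. f (flip D x)) = (\<Sum>x\<in>cube N. f x)"
    by (rule sum.reindex_bij_witness[where i = "flip D" and j = "flip D"])
      (use assms in \<open>auto simp: flip_flip flip_in_cube\<close>)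
  then show ?thesis by (simp add: cube_expectation_def)
qed

lemma cube_expectation_odd:
  assumes "D \<subseteq> {1..N}" and "\<And>x. x \<in> cube N \<Longrightarrow> f (flip D x) = - f x"
  shows "cube_expectation N f = 0"
proof -
  have "cube_expectation N f = cube_expectation N (\<lambda>x. f (flip D x))"
    using assms(1) by (simp add: cube_expectation_flip)
  also have "\<dots> = cube_expectation N (\<lambda>x. (-1) * f x)"
    using assms(2) by (intro cube_expectation_cong) simp
  also have "\<dots> = (-1) * cube_expectation N f" by (rule cube_expectation_cmult)
  finally show ?thesis by linarith
qed

lemma cube_expectation_walsh:
  assumes S: "S \<subseteq> {1..N}" "S \<noteq> {}"
  shows "cube_expectation N (walsh S) = 0"
proof -
  obtain i where i: "i \<in> S" using S by auto
  have fin: "finite S" using S by (auto intro: finite_subset)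
  show ?thesis
  proof (rule cube_expectation_odd[of "{i}"])
    fix x
    have "(\<Prod>k\<in>S - {i}. flip {i} x k) = (\<Prod>k\<in>S - {i}. x k)"
      by (rule prod.cong) (auto simp: flip_def)
    then show "walsh S (flip {i} x) = - walsh S x"
      unfolding walsh_def prod.remove[OF fin i] by (simp add: flip_def)
  qed (use i S in auto)
qed

section \<open>The lower bound on the radius\<close>

lemma sum_nonempty_Pow_power:
  fixes t :: real
  shows "(\<Sum>S\<in>Pow {1..N} - {{}}. t ^ card S) = (1 + t) ^ N - 1"
proof -
  have "(\<Sum>S\<in>Pow {1..N}. t ^ card S) = (t + 1) ^ N"
    using prod_add[of "{1..N}" "\<lambda>_. t" "\<lambda>_. 1"] by simp
  then show ?thesis by (simp add: sum_diff1 add.commute)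
qed

text \<open>The parameter \<open>\<eta> = 1 / (2 L)\<close> balances two losses. The exponent \<open>2 / (1 + \<eta>)\<close> is at least \<open>2 - 2 \<eta>\<close>,
  and \<open>m powr (- 2 \<eta>) = exp (2 \<eta> L) = exp 1\<close> is a constant, so the noise energy is of order \<open>m^2\<close>; and
  the dual weights \<open>\<rho>^2 / \<eta>\<close> stay below \<open>1 / (4 N)\<close>. The hypothesis \<open>m \<le> 1 / 2\<close> keeps \<open>\<eta>\<close> below \<open>1\<close>.\<close>

lemma nonconstant_coefficient_sum_le_mean:
  fixes g :: "(nat \<Rightarrow> real) \<Rightarrow> real" and \<rho> :: real and N :: nat
  defines "m \<equiv> cube_expectation N g"
  assumes g: "\<And>x. x \<in> cube N \<Longrightarrow> 0 \<le> g x \<and> g x \<le> 1"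
    and m: "0 < m" "m \<le> 1 / 2"
    and \<rho>: "0 \<le> \<rho>" "8 * real N * ln (1 / m) * \<rho>\<^sup>2 \<le> 1"
  shows "(\<Sum>S\<in>Pow {1..N} - {{}}. \<bar>fourier_coeff N g S\<bar> * \<rho> ^ card S) \<le> m"
proof -
  let ?I = "Pow {1..N} - {{}}"
  define L where "L = ln (1 / m)"
  have "1 / 2 \<le> ln (2::real)" using exp_half_le2 by (subst ln_ge_iff) auto
  also have "\<dots> \<le> L" unfolding L_def using m by (subst ln_le_cancel_iff) (auto simp: field_simps)
  finally have L: "1 / 2 \<le> L" .
  define \<eta> where "\<eta> = 1 / (2 * L)"
  have \<eta>: "0 < \<eta>" "\<eta> \<le> 1" using L by (auto simp: \<eta>_def divide_simps)
  define t where "t = \<rho>\<^sup>2 / \<eta>"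
  have t: "0 \<le> t" using \<eta> by (auto simp: t_def)
  have Nt: "real N * t \<le> 1 / 4" using \<rho>(2) by (simp add: t_def \<eta>_def L_def[symmetric] mult_ac)
  have "m powr (2 / (1 + \<eta>)) \<le> m powr (2 - 2 * \<eta>)"
  proof (rule powr_mono')
    have "(2 - 2 * \<eta>) * (1 + \<eta>) \<le> 2" by (simp add: algebra_simps)
    then show "2 - 2 * \<eta> \<le> 2 / (1 + \<eta>)" using \<eta> by (simp add: field_simps)
  qed (use m in auto)
  also have "\<dots> = m powr 2 * m powr (- 2 * \<eta>)" by (simp flip: powr_add)
  also have "m powr (- 2 * \<eta>) = exp 1"
    using m L by (simp add: powr_def \<eta>_def L_def ln_div)
  also have "m powr 2 * exp 1 \<le> m\<^sup>2 * 3"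
    using m exp_le by (intro mult_mono) auto
  finally have energy: "noise_energy N \<eta> g \<le> 3 * m\<^sup>2"
    using noise_energy_le_mean_powr[OF \<eta>, of N g] g by (simp add: m_def)
  have "(1 + t) ^ N \<le> exp t ^ N" using t by (intro power_mono) auto
  also have "\<dots> = exp (real N * t)" by (rule exp_of_nat_mult[symmetric])
  also have "\<dots> \<le> exp (1 / 4)" using Nt by simp
  also have "\<dots> \<le> 1 + 1 / 4 + (1 / 4)\<^sup>2" by (rule exp_bound) auto
  finally have tail: "(1 + t) ^ N - 1 \<le> 1 / 3" by (simp add: power2_eq_square)
  have tail0: "0 \<le> (1 + t) ^ N - 1" using t by simp
  have pow_sq: "(z ^ j)\<^sup>2 = (z\<^sup>2) ^ j" for z :: real and j
    unfolding power_mult[symmetric] by (simp add: mult.commute)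
  have t_eq: "(\<rho> / sqrt \<eta>)\<^sup>2 = t" using \<eta> by (simp add: t_def power_divide)
  have split: "\<bar>fourier_coeff N g S\<bar> * \<rho> ^ card S
      = (sqrt \<eta> ^ card S * \<bar>fourier_coeff N g S\<bar>) * (\<rho> / sqrt \<eta>) ^ card S" for S
    using \<eta> by (simp add: power_divide)
  have "(\<Sum>S\<in>?I. \<bar>fourier_coeff N g S\<bar> * \<rho> ^ card S)\<^sup>2
      \<le> (\<Sum>S\<in>?I. (sqrt \<eta> ^ card S * \<bar>fourier_coeff N g S\<bar>)\<^sup>2) * (\<Sum>S\<in>?I. ((\<rho> / sqrt \<eta>) ^ card S)\<^sup>2)"
    unfolding split by (rule Cauchy_Schwarz_ineq_sum)
  also have "(\<Sum>S\<in>?I. ((\<rho> / sqrt \<eta>) ^ card S)\<^sup>2) = (1 + t) ^ N - 1"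
    unfolding sum_nonempty_Pow_power[symmetric] pow_sq t_eq ..
  also have "(\<Sum>S\<in>?I. (sqrt \<eta> ^ card S * \<bar>fourier_coeff N g S\<bar>)\<^sup>2)
      = (\<Sum>S\<in>?I. \<eta> ^ card S * (fourier_coeff N g S)\<^sup>2)"
    unfolding power_mult_distrib pow_sq power2_abs real_sqrt_pow2[OF less_imp_le[OF \<eta>(1)]] ..
  also have "\<dots> * ((1 + t) ^ N - 1) \<le> noise_energy N \<eta> g * ((1 + t) ^ N - 1)"
    unfolding noise_energy_def using \<eta> tail0
    by (intro mult_right_mono sum_mono2) auto
  also have "\<dots> \<le> (3 * m\<^sup>2) * (1 / 3)"
    using energy tail tail0 by (intro mult_mono) auto
  also have "\<dots> = m\<^sup>2" by simp
  finally show ?thesis by (rule power2_le_imp_le) (use m in simp)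
qed

lemma abs_le_cube_sup_norm: "x \<in> cube N \<Longrightarrow> \<bar>f x\<bar> \<le> cube_sup_norm N f"
  unfolding cube_sup_norm_def by (intro Max_ge) auto

text \<open>With \<open>M\<close> the sup norm and \<open>a = |E f|\<close>, the function \<open>g = (M - \<sigma> f) / (2 M)\<close>, for the sign \<open>\<sigma>\<close> of \<open>E f\<close>, has
  mean \<open>(M - a) / (2 M)\<close> and nonconstant coefficients \<open>1 / (2 M)\<close> times those of \<open>f\<close> up to sign. So the
  bound for \<open>g\<close> says that the nonconstant terms of \<open>f\<close> fill at most the gap \<open>M - a\<close>.\<close>

lemma boolean_sum_le_sup_norm:
  assumes f: "f \<in> B_class N \<delta>" and \<delta>: "0 < \<delta>" "\<delta> \<le> 1"
    and \<rho>: "0 \<le> \<rho>" "8 * real N * ln (2 / \<delta>) * \<rho>\<^sup>2 \<le> 1"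
  shows "(\<Sum>S\<in>Pow {1..N}. \<bar>fourier_coeff N f S\<bar> * \<rho> ^ card S) \<le> cube_sup_norm N f"
proof -
  define M where "M = cube_sup_norm N f"
  obtain x0 where x0: "x0 \<in> cube N" using cube_nonempty by blast
  have bound: "\<bar>f x\<bar> \<le> M" if "x \<in> cube N" for x
    using abs_le_cube_sup_norm[OF that] by (simp add: M_def)
  have "0 \<le> M" using bound[OF x0] by linarith
  then consider "M = 0" | "M > 0" by linarith
  then show ?thesis
  proof cases
    case 1
    then have "fourier_coeff N f S = 0" for S
      using bound unfolding fourier_coeff_def cube_expectation_def by simp
    then show ?thesis using 1 by (simp add: M_def)
  next
    case 2
    define \<sigma> :: real where "\<sigma> = (if cube_expectation N f \<ge> 0 then 1 else - 1)"
    define a where "a = \<bar>cube_expectation N f\<bar>"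
    have \<sigma>: "\<bar>\<sigma>\<bar> = 1" "\<sigma> * cube_expectation N f = a" by (auto simp: \<sigma>_def a_def)
    define g where "g = (\<lambda>x. 1 / 2 - \<sigma> / (2 * M) * f x)"
    define m where "m = cube_expectation N g"
    have m_eq: "m = (M - a) / (2 * M)"
    proof -
      have "m = 1 / 2 - \<sigma> / (2 * M) * cube_expectation N f"
        unfolding m_def g_def
        by (simp only: cube_expectation_diff cube_expectation_cmult cube_expectation_const)
      then show ?thesis using 2 \<sigma>(2) by (simp add: field_simps)
    qed
    have a: "a \<le> (1 - \<delta>) * M" "0 \<le> a"
      using f by (auto simp: B_class_def a_def M_def)
    have m: "\<delta> / 2 \<le> m" "m \<le> 1 / 2"
      using a 2 by (auto simp: m_eq field_simps)
    have coeff: "\<bar>fourier_coeff N g S\<bar> = \<bar>fourier_coeff N f S\<bar> / (2 * M)" if "S \<in> Pow {1..N} - {{}}" for S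
    proof -
      have "fourier_coeff N g S
          = cube_expectation N (\<lambda>x. (1 / 2) * walsh S x - \<sigma> / (2 * M) * (f x * walsh S x))"
        unfolding fourier_coeff_def g_def by (rule cube_expectation_cong) (simp add: algebra_simps)
      also have "\<dots> = - (\<sigma> / (2 * M)) * fourier_coeff N f S"
        using that by (simp only: cube_expectation_diff cube_expectation_cmult fourier_coeff_def)
          (simp add: cube_expectation_walsh)
      finally show ?thesis using \<sigma> 2 by (simp add: abs_mult)
    qed
    have "(\<Sum>S\<in>Pow {1..N} - {{}}. \<bar>fourier_coeff N g S\<bar> * \<rho> ^ card S) \<le> m"
      unfolding m_def
    proof (rule nonconstant_coefficient_sum_le_mean)
      fix x assume "x \<in> cube N"
      then have "\<bar>\<sigma> * f x\<bar> \<le> M" using bound \<sigma> by (simp add: abs_mult)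
      then have "- M \<le> \<sigma> * f x" "\<sigma> * f x \<le> M" by linarith+
      then show "0 \<le> g x \<and> g x \<le> 1" using 2 by (simp add: g_def field_simps)
    next
      have "ln (1 / m) \<le> ln (2 / \<delta>)"
        using m \<delta> by (subst ln_le_cancel_iff) (auto simp: field_simps)
      then have "8 * real N * ln (1 / m) * \<rho>\<^sup>2 \<le> 8 * real N * ln (2 / \<delta>) * \<rho>\<^sup>2"
        by (intro mult_right_mono mult_left_mono) auto
      then show "8 * real N * ln (1 / cube_expectation N g) * \<rho>\<^sup>2 \<le> 1"
        using \<rho> by (simp add: m_def)
    qed (use m \<delta> \<rho> in \<open>auto simp: m_def\<close>)
    also have "(\<Sum>S\<in>Pow {1..N} - {{}}. \<bar>fourier_coeff N g S\<bar> * \<rho> ^ card S)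
        = (\<Sum>S\<in>Pow {1..N} - {{}}. \<bar>fourier_coeff N f S\<bar> * \<rho> ^ card S) / (2 * M)"
      by (simp add: coeff sum_divide_distrib)
    finally have "(\<Sum>S\<in>Pow {1..N} - {{}}. \<bar>fourier_coeff N f S\<bar> * \<rho> ^ card S) \<le> M - a"
      using 2 by (simp add: m_eq field_simps)
    moreover have "(\<Sum>S\<in>Pow {1..N}. \<bar>fourier_coeff N f S\<bar> * \<rho> ^ card S)
        = a + (\<Sum>S\<in>Pow {1..N} - {{}}. \<bar>fourier_coeff N f S\<bar> * \<rho> ^ card S)"
      by (subst sum.remove[of _ "{}"]) (auto simp: a_def fourier_coeff_def walsh_def)
    ultimately show ?thesis by (simp add: M_def)
  qed
qed

section \<open>Sums of signs\<close>

text \<open>Adding one more sign, the terms of odd degree in it average to zero, which gives the recursions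
  \<open>n + 1\<close> for the second moment and \<open>3 n^2 + 6 n + 1 \<le> 3 (n + 1)^2\<close> for the fourth.\<close>

lemma coordinate_sum_moments:
  assumes "finite D" "D \<subseteq> {1..N}"
  shows "cube_expectation N (\<lambda>x. (\<Sum>i\<in>D. x i)\<^sup>2) = real (card D)"
    and "cube_expectation N (\<lambda>x. (\<Sum>i\<in>D. x i) ^ 4) \<le> 3 * (real (card D))\<^sup>2"
proof -
  have "cube_expectation N (\<lambda>x. (\<Sum>i\<in>D. x i)\<^sup>2) = real (card D) \<and>
    cube_expectation N (\<lambda>x. (\<Sum>i\<in>D. x i) ^ 4) \<le> 3 * (real (card D))\<^sup>2"
    using assms
  proof (induction D rule: finite_induct)
    case empty
    then show ?case by (simp add: cube_expectation_const)
  next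
    case (insert i D)
    let ?Y = "\<lambda>x::nat \<Rightarrow> real. \<Sum>j\<in>D. x j"
    have sub: "{i} \<subseteq> {1..N}" using insert by auto
    have IH: "cube_expectation N (\<lambda>x. (?Y x)\<^sup>2) = real (card D)"
      "cube_expectation N (\<lambda>x. (?Y x) ^ 4) \<le> 3 * (real (card D))\<^sup>2"
      using insert by auto
    have Y: "?Y (flip {i} x) = ?Y x" for x
      using insert by (intro sum.cong) (auto simp: flip_def)
    have odd: "cube_expectation N (\<lambda>x. x i * h (?Y x)) = 0" for h
      by (rule cube_expectation_odd[OF sub]) (simp only: Y, simp add: flip_def)
    have sq: "(x i)\<^sup>2 = 1" if "x \<in> cube N" for x
      using cube_coordinate[OF that, of i] sub by auto
    have "cube_expectation N (\<lambda>x. (\<Sum>j\<in>insert i D. x j)\<^sup>2)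
        = cube_expectation N (\<lambda>x. (?Y x)\<^sup>2 + 2 * (x i * ?Y x) + 1)"
    proof (rule cube_expectation_cong)
      fix x assume "x \<in> cube N"
      from sq[OF this] show "(\<Sum>j\<in>insert i D. x j)\<^sup>2 = (?Y x)\<^sup>2 + 2 * (x i * ?Y x) + 1"
        using insert by (simp add: power2_sum)
    qed
    also have "\<dots> = real (card D) + 1"
      using IH odd[of "\<lambda>y. y"] by (simp add: cube_expectation_add cube_expectation_cmult cube_expectation_const)
    finally have 1: "cube_expectation N (\<lambda>x. (\<Sum>j\<in>insert i D. x j)\<^sup>2) = real (card D) + 1" .
    have "cube_expectation N (\<lambda>x. (\<Sum>j\<in>insert i D. x j) ^ 4)
        = cube_expectation N (\<lambda>x. ((?Y x) ^ 4 + 6 * (?Y x)\<^sup>2 + 1) + x i * (4 * (?Y x) ^ 3 + 4 * ?Y x))"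
    proof (rule cube_expectation_cong)
      fix x assume "x \<in> cube N"
      from sq[OF this] have x: "x i * (x i * z) = z" for z
        by (metis mult.assoc mult_1 power2_eq_square)
      have "(x i + ?Y x) ^ 4 = (?Y x) ^ 4 + 6 * (?Y x)\<^sup>2 + 1 + x i * (4 * (?Y x) ^ 3 + 4 * ?Y x)"
        using x[of 1] by (simp add: power2_eq_square power3_eq_cube power4_eq_xxxx algebra_simps x)
      then show "(\<Sum>j\<in>insert i D. x j) ^ 4
          = ((?Y x) ^ 4 + 6 * (?Y x)\<^sup>2 + 1) + x i * (4 * (?Y x) ^ 3 + 4 * ?Y x)"
        using insert by simp
    qed
    also have "\<dots> = cube_expectation N (\<lambda>x. (?Y x) ^ 4) + 6 * real (card D) + 1"
      using IH odd[of "\<lambda>y. 4 * y ^ 3 + 4 * y"]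
      by (simp only: cube_expectation_add cube_expectation_cmult cube_expectation_const)
    also have "\<dots> \<le> 3 * (real (card D))\<^sup>2 + 6 * real (card D) + 1"
      using IH by simp
    also have "\<dots> \<le> 3 * (real (card D) + 1)\<^sup>2"
      by (simp add: power2_sum)
    finally show ?case using 1 insert by (simp add: add.commute)
  qed
  then show "cube_expectation N (\<lambda>x. (\<Sum>i\<in>D. x i)\<^sup>2) = real (card D)"
    and "cube_expectation N (\<lambda>x. (\<Sum>i\<in>D. x i) ^ 4) \<le> 3 * (real (card D))\<^sup>2" by auto
qed

text \<open>The first moment is bounded below by the second and fourth through a pointwise inequality
  \<open>|y| \<ge> \<alpha> y^2 - \<beta> y^4\<close>, the integrated form of which is linear in the moments.\<close>

lemma Khinchine_first_moment:
  assumes "D \<subseteq> {1..N}" "D \<noteq> {}"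
  shows "sqrt (real (card D)) / 2 \<le> cube_expectation N (\<lambda>x. \<bar>\<Sum>i\<in>D. x i\<bar>)"
proof -
  have fin: "finite D" using assms by (auto intro: finite_subset)
  define s where "s = sqrt (real (card D))"
  have s: "0 < s" "s\<^sup>2 = real (card D)" using assms fin by (auto simp: s_def card_gt_0_iff)
  let ?Y = "\<lambda>x::nat \<Rightarrow> real. \<Sum>i\<in>D. x i"
  (* The cubic below touches zero to second order at 2 s. This double root is close to the value
     sqrt 3 * s that gives the best constant, and it keeps all coefficients integral. *)
  have pointwise: "12 * s\<^sup>2 * y\<^sup>2 - y ^ 4 \<le> 16 * s ^ 3 * \<bar>y\<bar>" for y :: real
  proof -
    have "0 \<le> \<bar>y\<bar> * ((\<bar>y\<bar> - 2 * s)\<^sup>2 * (\<bar>y\<bar> + 4 * s))" using s by simp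
    also have "\<dots> = \<bar>y\<bar> ^ 4 - 12 * s\<^sup>2 * \<bar>y\<bar>\<^sup>2 + 16 * s ^ 3 * \<bar>y\<bar>"
      by (simp add: power2_eq_square power3_eq_cube power4_eq_xxxx algebra_simps)
    finally show ?thesis by simp
  qed
  have "12 * s\<^sup>2 * s\<^sup>2 - 3 * (s\<^sup>2)\<^sup>2
      \<le> cube_expectation N (\<lambda>x. (12 * s\<^sup>2) * (?Y x)\<^sup>2 - (?Y x) ^ 4)"
    using coordinate_sum_moments[OF fin assms(1)] s
    by (simp add: cube_expectation_diff cube_expectation_cmult)
  also have "\<dots> \<le> cube_expectation N (\<lambda>x. (16 * s ^ 3) * \<bar>?Y x\<bar>)"
    by (intro cube_expectation_mono pointwise)
  also have "\<dots> = (16 * s ^ 3) * cube_expectation N (\<lambda>x. \<bar>?Y x\<bar>)"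
    by (rule cube_expectation_cmult)
  finally have "s ^ 3 * (9 * s) \<le> s ^ 3 * (16 * cube_expectation N (\<lambda>x. \<bar>?Y x\<bar>))"
    by (simp add: power2_eq_square power3_eq_cube algebra_simps)
  then have "9 * s \<le> 16 * cube_expectation N (\<lambda>x. \<bar>?Y x\<bar>)" using s by simp
  then show ?thesis using s(1) by (simp add: s_def[symmetric])
qed

lemma odd_coordinate_sum_nonzero:
  assumes "finite D" "odd (card D)" "D \<subseteq> {1..N}" "x \<in> cube N"
  shows "(\<Sum>i\<in>D. x i) \<noteq> 0"
proof -
  have "\<exists>z::int. (\<Sum>i\<in>D. x i) = of_int z \<and> (even z \<longleftrightarrow> even (card D))"
    using assms(1,3)
  proof (induction D rule: finite_induct)
    case empty
    show ?case by (intro exI[of _ 0]) simp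
  next
    case (insert i D)
    then obtain z :: int where z: "(\<Sum>i\<in>D. x i) = of_int z" "even z \<longleftrightarrow> even (card D)" by auto
    have "x i = 1 \<or> x i = - 1" using cube_coordinate[OF assms(4)] insert by auto
    then show ?case
    proof
      assume "x i = 1"
      then show ?thesis using insert z by (intro exI[of _ "z + 1"]) simp
    next
      assume "x i = - 1"
      then show ?thesis using insert z by (intro exI[of _ "z - 1"]) simp
    qed
  qed
  then show ?thesis using assms(2) by auto
qed

section \<open>The block test function\<close>

lemma coordinate_sum_flip:
  assumes "disjoint_family_on D I" "b \<in> I" "c \<in> I"
  shows "(\<Sum>i\<in>D b. flip (D c) x i) = (if b = c then - (\<Sum>i\<in>D b. x i) else (\<Sum>i\<in>D b. x i))"
proof (cases "b = c")
  case True
  then show ?thesis by (simp add: flip_def sum_negf)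
next
  case False
  then have "D b \<inter> D c = {}" using assms by (auto simp: disjoint_family_on_def)
  then show ?thesis using False by (auto simp: flip_def intro!: sum.cong)
qed

text \<open>Flipping a whole block exchanges the events that its sum is positive and that it is negative, and
  preserves the other block sums and \<open>h\<close>. Since an odd number of signs never adds up to zero, each new
  block halves the expectation.\<close>

lemma cube_expectation_all_positive:
  fixes h :: "(nat \<Rightarrow> real) \<Rightarrow> real"
  assumes disj: "disjoint_family_on D {..<k}"
    and D: "\<And>b. b < k \<Longrightarrow> D b \<subseteq> {1..N}" "\<And>b. b < k \<Longrightarrow> odd (card (D b))"
    and h: "\<And>b x. b < k \<Longrightarrow> h (flip (D b) x) = h x"
    and j: "j \<le> k"
  shows "cube_expectation N (\<lambda>x. of_bool (\<forall>b<j. 0 < (\<Sum>i\<in>D b. x i)) * h x) = cube_expectation N h / 2 ^ j"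
  using j
proof (induction j)
  case 0
  then show ?case by simp
next
  case (Suc j)
  then have jk: "j < k" by simp
  let ?Y = "\<lambda>b x. \<Sum>i\<in>D b. x i :: real"
  let ?P = "\<lambda>x. of_bool (\<forall>b<j. 0 < ?Y b x) :: real"
  let ?F = "\<lambda>x. ?P x * of_bool (0 < ?Y j x) * h x"
  have flip_F: "?F (flip (D j) x) = ?P x * of_bool (?Y j x < 0) * h x" for x
  proof -
    have "?Y b (flip (D j) x) = ?Y b x" if "b < j" for b
      using coordinate_sum_flip[OF disj, of b j x] that jk by auto
    moreover have "?Y j (flip (D j) x) = - ?Y j x"
      using coordinate_sum_flip[OF disj, of j j x] jk by auto
    ultimately show ?thesis using h[OF jk] by simp
  qed
  have "cube_expectation N (\<lambda>x. ?P x * h x) = cube_expectation N (\<lambda>x. ?F x + ?F (flip (D j) x))"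
  proof (rule cube_expectation_cong)
    fix x assume "x \<in> cube N"
    then have "?Y j x \<noteq> 0"
      using D jk by (intro odd_coordinate_sum_nonzero[where N = N]) (auto intro: finite_subset)
    then show "?P x * h x = ?F x + ?F (flip (D j) x)"
      unfolding flip_F by auto
  qed
  also have "\<dots> = 2 * cube_expectation N ?F"
    using D(1)[OF jk] by (simp only: cube_expectation_add cube_expectation_flip[of _ _ ?F])
  finally have "cube_expectation N ?F = cube_expectation N (\<lambda>x. ?P x * h x) / 2" by simp
  moreover have "(\<lambda>x. of_bool (\<forall>b<Suc j. 0 < ?Y b x) * h x) = ?F"
    by (auto simp: less_Suc_eq fun_eq_iff)
  ultimately show ?case using Suc by simp
qed

text \<open>Both expectations that are needed, the measure of the event and the sum of the degree-one
  coefficients, come from the block flips: the constant \<open>1\<close> and the sum of the absolute block sums are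
  invariant under them.\<close>

lemma block_test_function:
  assumes disj: "disjoint_family_on D {..<k}"
    and D: "\<And>b. b < k \<Longrightarrow> D b \<subseteq> {1..N}" "\<And>b. b < k \<Longrightarrow> card (D b) = n" and n: "odd n"
  defines "f \<equiv> \<lambda>x :: nat \<Rightarrow> real. 1 - 2 * of_bool (\<forall>b<k. 0 < (\<Sum>i\<in>D b. x i)) :: real"
  shows "cube_sup_norm N f = 1"
    and "cube_expectation N f = 1 - 2 / 2 ^ k"
    and "real k * sqrt (real n) / 2 ^ k \<le> (\<Sum>i\<in>(\<Union>b<k. D b). \<bar>fourier_coeff N f {i}\<bar>)"
proof -
  let ?Y = "\<lambda>b x. \<Sum>i\<in>D b. x i :: real"
  let ?A = "\<lambda>x. of_bool (\<forall>b<k. 0 < ?Y b x) :: real"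
  let ?U = "\<Union>b<k. D b"
  have odd_card: "\<And>b. b < k \<Longrightarrow> odd (card (D b))" using D n by simp
  have all_pos: "cube_expectation N (\<lambda>x. ?A x * h x) = cube_expectation N h / 2 ^ k"
    if "\<And>b x. b < k \<Longrightarrow> h (flip (D b) x) = h x" for h
    using disj D(1) odd_card that by (rule cube_expectation_all_positive) auto
  have "(\<lambda>x. \<bar>f x\<bar>) ` cube N = {1}"
    using cube_nonempty[of N] by (auto simp: f_def image_iff ex_in_conv)
  then show "cube_sup_norm N f = 1" by (simp add: cube_sup_norm_def)
  have "cube_expectation N ?A = 1 / 2 ^ k"
    using all_pos[of "\<lambda>_. 1"] by (simp add: cube_expectation_const)
  then show "cube_expectation N f = 1 - 2 / 2 ^ k"
    by (simp add: f_def cube_expectation_diff cube_expectation_cmult cube_expectation_const)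
  have fin: "finite (D b)" if "b < k" for b using D(1)[OF that] by (rule finite_subset) simp
  have sum_U: "(\<Sum>i\<in>?U. z i) = (\<Sum>b<k. \<Sum>i\<in>D b. z i)" for z :: "nat \<Rightarrow> real"
    using disj fin by (intro sum.UNION_disjoint_family) auto
  have lin: "(\<Sum>i\<in>?U. - fourier_coeff N f {i}) = 2 * cube_expectation N (\<lambda>x. ?A x * (\<Sum>b<k. \<bar>?Y b x\<bar>))"
  proof -
    have zero: "cube_expectation N (\<lambda>x. x i) = 0" if "i \<in> ?U" for i
    proof -
      have "{i} \<subseteq> {1..N}" using that D(1) by blast
      then have "cube_expectation N (walsh {i}) = 0" by (intro cube_expectation_walsh) auto
      moreover have "walsh {i} = (\<lambda>x. x i)" by (simp add: walsh_def fun_eq_iff)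
      ultimately show ?thesis by simp
    qed
    have coeff: "- fourier_coeff N f {i} = cube_expectation N (\<lambda>x. 2 * (?A x * x i))" if "i \<in> ?U" for i
    proof -
      have "fourier_coeff N f {i} = cube_expectation N (\<lambda>x. x i - 2 * (?A x * x i))"
        unfolding fourier_coeff_def f_def walsh_def by (rule cube_expectation_cong) (simp add: algebra_simps)
      then show ?thesis using zero[OF that] by (simp add: cube_expectation_diff)
    qed
    have "(\<Sum>i\<in>?U. - fourier_coeff N f {i}) = (\<Sum>i\<in>?U. cube_expectation N (\<lambda>x. 2 * (?A x * x i)))"
      using coeff by (rule sum.cong[OF refl])
    also have "\<dots> = cube_expectation N (\<lambda>x. \<Sum>i\<in>?U. 2 * (?A x * x i))"
      by (rule cube_expectation_sum[symmetric])
    also have "\<dots> = cube_expectation N (\<lambda>x. 2 * (?A x * (\<Sum>b<k. \<bar>?Y b x\<bar>)))"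
    proof (rule cube_expectation_cong)
      fix x
      have "?A x * (\<Sum>b<k. ?Y b x) = ?A x * (\<Sum>b<k. \<bar>?Y b x\<bar>)"
        by (cases "\<forall>b<k. 0 < ?Y b x") (auto intro!: sum.cong)
      then show "(\<Sum>i\<in>?U. 2 * (?A x * x i)) = 2 * (?A x * (\<Sum>b<k. \<bar>?Y b x\<bar>))"
        by (simp only: sum_distrib_left[symmetric] sum_U)
    qed
    also have "\<dots> = 2 * cube_expectation N (\<lambda>x. ?A x * (\<Sum>b<k. \<bar>?Y b x\<bar>))"
      by (rule cube_expectation_cmult)
    finally show ?thesis .
  qed
  have "real k * (sqrt (real n) / 2) = (\<Sum>b<k. sqrt (real n) / 2)" by simp
  also have "\<dots> \<le> (\<Sum>b<k. cube_expectation N (\<lambda>x. \<bar>?Y b x\<bar>))"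
  proof (rule sum_mono)
    fix b assume "b \<in> {..<k}"
    then have b: "b < k" by simp
    have "D b \<noteq> {}" using D(2)[OF b] n by auto
    then show "sqrt (real n) / 2 \<le> cube_expectation N (\<lambda>x. \<bar>?Y b x\<bar>)"
      using Khinchine_first_moment[OF D(1)[OF b]] D(2)[OF b] by simp
  qed
  also have "\<dots> = cube_expectation N (\<lambda>x. \<Sum>b<k. \<bar>?Y b x\<bar>)"
    by (rule cube_expectation_sum[symmetric])
  finally have mean: "real k * (sqrt (real n) / 2) \<le> cube_expectation N (\<lambda>x. \<Sum>b<k. \<bar>?Y b x\<bar>)" .
  have "(\<Sum>b<k. \<bar>?Y b (flip (D c) x)\<bar>) = (\<Sum>b<k. \<bar>?Y b x\<bar>)" if "c < k" for c x
    using coordinate_sum_flip[OF disj, of _ c x] that by (intro sum.cong) auto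
  then have "cube_expectation N (\<lambda>x. ?A x * (\<Sum>b<k. \<bar>?Y b x\<bar>))
      = cube_expectation N (\<lambda>x. \<Sum>b<k. \<bar>?Y b x\<bar>) / 2 ^ k"
    by (rule all_pos[of "\<lambda>x. \<Sum>b<k. \<bar>?Y b x\<bar>"])
  with mean lin have "real k * sqrt (real n) / 2 ^ k \<le> (\<Sum>i\<in>?U. - fourier_coeff N f {i})"
    by (simp add: divide_right_mono)
  also have "\<dots> \<le> (\<Sum>i\<in>?U. \<bar>fourier_coeff N f {i}\<bar>)" by (intro sum_mono) auto
  finally show "real k * sqrt (real n) / 2 ^ k \<le> (\<Sum>i\<in>?U. \<bar>fourier_coeff N f {i}\<bar>)" .
qed

lemma constant_plus_linear_part_le:
  assumes "U \<subseteq> {1..N}" "0 \<le> \<rho>"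
  shows "\<bar>cube_expectation N f\<bar> + \<rho> * (\<Sum>i\<in>U. \<bar>fourier_coeff N f {i}\<bar>)
    \<le> (\<Sum>S\<in>Pow {1..N}. \<bar>fourier_coeff N f S\<bar> * \<rho> ^ card S)"
proof -
  let ?F = "\<lambda>S. \<bar>fourier_coeff N f S\<bar> * \<rho> ^ card S"
  have fin: "finite U" using assms(1) by (rule finite_subset) simp
  have "(\<Sum>S\<in>insert {} ((\<lambda>i. {i}) ` U). ?F S) \<le> (\<Sum>S\<in>Pow {1..N}. ?F S)"
    using assms by (intro sum_mono2) auto
  moreover have "(\<Sum>S\<in>insert {} ((\<lambda>i. {i}) ` U). ?F S) = ?F {} + (\<Sum>S\<in>(\<lambda>i. {i}) ` U. ?F S)"
    using fin by (intro sum.insert) auto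
  moreover have "(\<Sum>S\<in>(\<lambda>i. {i}) ` U. ?F S) = \<rho> * (\<Sum>i\<in>U. \<bar>fourier_coeff N f {i}\<bar>)"
    by (subst sum.reindex) (auto simp: sum_distrib_left mult.commute)
  ultimately show ?thesis by (simp add: fourier_coeff_def walsh_def)
qed

section \<open>The upper bound on the radius\<close>

lemma dyadic_scale:
  fixes \<delta> :: real
  assumes "1 \<le> N" "1 / 2 ^ N \<le> \<delta>" "\<delta> \<le> 1"
  obtains k where "1 \<le> k" "k \<le> N" "1 / 2 ^ k \<le> \<delta>" "\<delta> \<le> 2 / 2 ^ k"
proof -
  define k where "k = (LEAST k. 1 \<le> k \<and> 1 / 2 ^ k \<le> \<delta>)"
  have k: "1 \<le> k \<and> 1 / 2 ^ k \<le> \<delta>" unfolding k_def by (rule LeastI[of _ N]) (use assms in auto)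
  have "k \<le> N" unfolding k_def by (rule Least_le) (use assms in auto)
  moreover have "\<delta> \<le> 2 / 2 ^ k"
  proof (cases "k = 1")
    case True
    then show ?thesis using assms by simp
  next
    case False
    then have k2: "k = Suc (k - 1)" "1 \<le> k - 1" using k by auto
    have "k - 1 < (LEAST k. 1 \<le> k \<and> 1 / 2 ^ k \<le> \<delta>)"
      unfolding k_def[symmetric] using k by linarith
    then have "\<not> (1 \<le> k - 1 \<and> 1 / 2 ^ (k - 1) \<le> \<delta>)" by (rule not_less_Least)
    then have "\<delta> \<le> 1 / 2 ^ (k - 1)" using k2 by auto
    also have "\<dots> = 2 / 2 ^ k" by (subst (2) k2(1)) simp
    finally show ?thesis .
  qed
  ultimately show ?thesis using k that by auto
qed

lemma odd_block_length:
  fixes k N :: nat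
  assumes "1 \<le> k" "k \<le> N"
  obtains n where "odd n" "k * n \<le> N" "N \<le> 4 * k * n"
proof -
  (* Rounding down to an odd number costs at most a factor 2, as does the division N div k. *)
  define q where "q = N div k"
  have q: "1 \<le> q" using assms by (simp add: q_def Suc_le_eq div_greater_zero_iff)
  have kq: "k * q \<le> N" by (simp add: q_def)
  have "N < k * (q + 1)"
    using assms dividend_less_times_div[of k N] by (simp add: q_def)
  then have Nq: "N \<le> k * (q + 1)" by simp
  define n where "n = (if odd q then q else q - 1)"
  have n: "odd n" "n \<le> q" "q + 1 \<le> 4 * n" using q by (auto simp: n_def elim!: evenE)
  have "k * n \<le> N" using n kq by (meson le_trans mult_le_mono2)
  moreover have "N \<le> 4 * k * n"
    using Nq mult_le_mono2[OF n(3), of k] by (simp add: algebra_simps)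
  ultimately show ?thesis using that n by blast
qed

text \<open>The block test function, with \<open>2 ^ -k\<close> within a factor \<open>2\<close> of \<open>\<delta>\<close> and \<open>n \<ge> N / (4 k)\<close>, gives
  \<open>\<rho> \<le> 2 / (k sqrt n)\<close>. Here \<open>L \<le> (k + 1) ln 2 \<le> 2 k\<close>, so \<open>N L \<le> 8 k^2 n \<le> (3 k sqrt n)^2\<close>, which is where the
  constant \<open>6\<close> comes from.\<close>

lemma admissible_radius_le:
  fixes \<delta> \<rho> :: real
  assumes N: "1 \<le> N" and \<delta>: "1 / 2 ^ N \<le> \<delta>" "\<delta> \<le> 1" and \<rho>: "0 \<le> \<rho>"
    and adm: "\<And>f. f \<in> B_class N \<delta> \<Longrightarrow>
      (\<Sum>S\<in>Pow {1..N}. \<bar>fourier_coeff N f S\<bar> * \<rho> ^ card S) \<le> cube_sup_norm N f"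
  shows "\<rho> \<le> 6 / (sqrt (real N) * sqrt (ln (2 / \<delta>)))"
proof -
  have \<delta>0: "0 < \<delta>" using \<delta>(1) by (rule less_le_trans[rotated]) simp
  obtain k where k: "1 \<le> k" "k \<le> N" "1 / 2 ^ k \<le> \<delta>" "\<delta> \<le> 2 / 2 ^ k"
    using dyadic_scale[OF N \<delta>] .
  obtain n where n: "odd n" "k * n \<le> N" "N \<le> 4 * k * n"
    using odd_block_length[OF k(1,2)] .
  define D where "D = (\<lambda>b. {b * n + 1..b * n + n})"
  have disj: "disjoint_family_on D {..<k}"
  proof -
    have "D b \<inter> D c = {}" if "b < c" for b c
    proof -
      have "Suc b * n \<le> c * n" using that by (intro mult_le_mono1) simp
      then show ?thesis by (auto simp: D_def)
    qed
    then have "D b \<inter> D c = {}" if "b \<noteq> c" for b c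
      using that by (metis Int_commute nat_neq_iff)
    then show ?thesis by (auto simp: disjoint_family_on_def)
  qed
  have sub: "D b \<subseteq> {1..N}" if "b < k" for b
  proof -
    have "Suc b * n \<le> k * n" using that by (intro mult_le_mono1) simp
    then show ?thesis using n(2) by (auto simp: D_def)
  qed
  have card: "card (D b) = n" for b by (simp add: D_def)
  define f where "f = (\<lambda>x :: nat \<Rightarrow> real. 1 - 2 * of_bool (\<forall>b<k. 0 < (\<Sum>i\<in>D b. x i)) :: real)"
  let ?U = "\<Union>b<k. D b"
  have norm: "cube_sup_norm N f = 1"
    and mean: "cube_expectation N f = 1 - 2 / 2 ^ k"
    and lin: "real k * sqrt (real n) / 2 ^ k \<le> (\<Sum>i\<in>?U. \<bar>fourier_coeff N f {i}\<bar>)"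
    unfolding f_def using block_test_function[OF disj sub card n(1)] by auto
  have "(2::real) ^ 1 \<le> 2 ^ k" using k(1) by (intro power_increasing) auto
  then have mean0: "0 \<le> 1 - 2 / (2::real) ^ k" by simp
  have "\<delta> \<le> 2 / 2 ^ k" by (rule k(4))
  then have "f \<in> B_class N \<delta>"
    using mean0 by (simp add: B_class_def norm mean)
  then have "\<bar>cube_expectation N f\<bar> + \<rho> * (\<Sum>i\<in>?U. \<bar>fourier_coeff N f {i}\<bar>) \<le> 1"
    using adm[of f] constant_plus_linear_part_le[of ?U N \<rho> f] sub \<rho> norm by fastforce
  moreover have "\<rho> * (real k * sqrt (real n) / 2 ^ k) \<le> \<rho> * (\<Sum>i\<in>?U. \<bar>fourier_coeff N f {i}\<bar>)"
    using lin \<rho> by (rule mult_left_mono)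
  ultimately have "\<rho> * (real k * sqrt (real n) / 2 ^ k) \<le> 2 / 2 ^ k"
    using mean mean0 by simp
  then have "(\<rho> * (real k * sqrt (real n))) / 2 ^ k \<le> 2 / 2 ^ k" by simp
  then have main: "\<rho> * (real k * sqrt (real n)) \<le> 2"
    by (subst (asm) divide_le_cancel) auto
  have n0: "0 < n" using n(1) by (cases n) auto
  have L0: "0 < ln (2 / \<delta>)" using \<delta> \<delta>0 by simp
  have "ln (2 / \<delta>) \<le> ln (2 ^ Suc k)"
    using k(3) \<delta>0 by (subst ln_le_cancel_iff) (auto simp: field_simps)
  also have "\<dots> = real (Suc k) * ln 2" by (simp only: ln_realpow)
  also have "\<dots> \<le> real (Suc k) * 1" using ln_2_less_1 by (intro mult_left_mono) auto
  also have "\<dots> \<le> 2 * real k" using k(1) by simp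
  finally have L: "ln (2 / \<delta>) \<le> 2 * real k" .
  have "real N \<le> real (4 * k * n)" using n(3) by (rule of_nat_mono)
  then have N4: "real N \<le> 4 * real k * real n" by simp
  have "real N * ln (2 / \<delta>) \<le> (4 * real k * real n) * (2 * real k)"
    using N4 L L0 by (intro mult_mono) auto
  also have "\<dots> = 8 * ((real k)\<^sup>2 * real n)" by (simp add: power2_eq_square)
  also have "\<dots> \<le> 9 * ((real k)\<^sup>2 * real n)" by simp
  also have "\<dots> = (3 * (real k * sqrt (real n)))\<^sup>2" by (simp add: power_mult_distrib)
  finally have "sqrt (real N) * sqrt (ln (2 / \<delta>)) \<le> 3 * (real k * sqrt (real n))"
    unfolding real_sqrt_mult[symmetric] by (intro real_le_lsqrt) auto
  then have "\<rho> * (sqrt (real N) * sqrt (ln (2 / \<delta>))) \<le> \<rho> * (3 * (real k * sqrt (real n)))"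
    using \<rho> by (rule mult_left_mono)
  also have "\<dots> \<le> 6" using main by simp
  finally show ?thesis using N L0 by (simp add: pos_le_divide_eq)
qed

text \<open>Both bounds hold with \<open>C = 6\<close>: the upper bound by the block test function, and the lower one because
  \<open>\<rho> = 1 / (6 sqrt (N L))\<close> satisfies \<open>8 N L \<rho>^2 = 8 / 36 \<le> 1\<close>.\<close>

theorem theorem5p1:
  "\<exists>C::real. C > 0 \<and>
     (\<forall>(N::nat) (\<delta>::real). N \<ge> 1 \<and> 1 / 2 ^ N \<le> \<delta> \<and> \<delta> \<le> 1 \<longrightarrow>
        ereal (inverse C / (sqrt (real N) * sqrt (ln (2 / \<delta>)))) \<le> boolean_radius N (B_class N \<delta>) \<and>
        boolean_radius N (B_class N \<delta>) \<le> ereal (C / (sqrt (real N) * sqrt (ln (2 / \<delta>)))))"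
proof (intro exI[of _ 6] conjI allI impI)
  fix N :: nat and \<delta> :: real
  assume asm: "N \<ge> 1 \<and> 1 / 2 ^ N \<le> \<delta> \<and> \<delta> \<le> 1"
  then have \<delta>0: "0 < \<delta>" by (auto intro: less_le_trans[rotated])
  have L0: "0 < ln (2 / \<delta>)" using asm \<delta>0 by simp
  define \<rho> where "\<rho> = inverse 6 / (sqrt (real N) * sqrt (ln (2 / \<delta>)))"
  have "8 * real N * ln (2 / \<delta>) * \<rho>\<^sup>2 \<le> 1"
    using asm L0 by (simp add: \<rho>_def power_divide power_mult_distrib)
  moreover have "0 \<le> \<rho>" using L0 by (simp add: \<rho>_def)
  ultimately show "ereal (inverse 6 / (sqrt (real N) * sqrt (ln (2 / \<delta>)))) \<le> boolean_radius N (B_class N \<delta>)"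
    unfolding boolean_radius_def \<rho>_def[symmetric] using asm \<delta>0
    by (intro Sup_upper imageI CollectI conjI ballI boolean_sum_le_sup_norm[where \<delta> = \<delta>]) auto
  show "boolean_radius N (B_class N \<delta>) \<le> ereal (6 / (sqrt (real N) * sqrt (ln (2 / \<delta>))))"
    unfolding boolean_radius_def
  proof (rule Sup_least, elim imageE, clarify)
    fix \<rho> :: real
    assume "0 \<le> \<rho>" and "\<forall>f\<in>B_class N \<delta>.
      (\<Sum>S\<in>Pow {1..N}. \<bar>fourier_coeff N f S\<bar> * \<rho> ^ card S) \<le> cube_sup_norm N f"
    then show "ereal \<rho> \<le> ereal (6 / (sqrt (real N) * sqrt (ln (2 / \<delta>))))"
      using asm admissible_radius_le[of N \<delta> \<rho>] by auto
  qed
qed simp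

end
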